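(* Let $\varphi(t)$ be a geodesic in $\mathcal M$ for the Levi-Civita connection $D^D$ of the Dirichlet metric, and let $u=G_\varphi\varphi_t$. Then $\varphi(t)$ satisfies the system $$\begin{cases}\varphi_t=\Delta_\varphi u,\\[2pt] \varphi_{tt}=d\Big\{-g(\varphi_t,\varphi)\,\delta u+\tfrac12\,\delta\big[g(\delta u,\delta u)\,\varphi-\mathrm i_\varphi\,\mathrm j_{\delta u}(\delta u)\big]+\tfrac12\,\mathrm i_{\delta u}\,\mathrm j_\varphi\varphi_t\Big\}.\end{cases}$$
   Context: $M$ is a compact oriented smooth 7-manifold. A 3-form $\varphi$ on $M$ is positive (a $G_2$-structure) if the $\Lambda^7T^*M$-valued quadratic form $Q_\varphi(a,b)=(a\lrcorner\varphi)\wedge(b\lrcorner\varphi)\wedge\varphi$ is positive definite; it determines a unique Riemannian metric $g=g_\varphi$ with $6g_\varphi=*_\varphi Q_\varphi$, Hodge star $*=*_\varphi$, volume form $\mathrm{vol}=*1$, codifferential $\delta=(-1)^k*d*$ on $k$-forms, and Hodge Laplacian $\Delta=d\delta+\delta d$; all these operators depend on $\varphi$. Fix $c\in H^3(M)$; $\mathcal M$ is the (assumed non-empty) space of closed positive 3-forms in the class $c$, with $T_\varphi\mathcal M=d\Omega^2(M)$. For a $d$-exact 3-form $X$, $G_\varphi X$ is the unique $d$-exact 3-form with $\Delta_\varphi G_\varphi X=X$. Inner products: for $k$-forms and for $(0,k)$-tensors, $g(S,\bar S)=\frac1{k!}S_{i_1\cdots i_k}\bar S_{j_1\cdots j_k}g^{i_1j_1}\cdots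 g^{i_kj_k}$, where a $k$-form is written $\omega=\frac1{k!}\omega_{i_1\cdots i_k}dx^{i_1\cdots i_k}$. For a $p$-form $\omega$, a symmetric 2-tensor $h$ and a $p$-form $\eta$: $\mathrm i_\omega h=\frac1{(p-1)!}h_{i_1l}g^{ls}\omega_{si_2\cdots i_p}dx^{i_1\cdots i_p}$ and $\mathrm j_\omega\eta=\frac12[\omega_{ia_2\cdots a_p}\eta_j{}^{a_2\cdots a_p}+\omega_{ja_2\cdots a_p}\eta_i{}^{a_2\cdots a_p}]dx^i\otimes dx^j$. The Dirichlet metric is $\mathcal G^D_\varphi(X,Y)=\int_M g(\delta G_\varphi X,\delta G_\varphi Y)\,\mathrm{vol}$ on $T_\varphi\mathcal M$. Its Levi-Civita connection is, for a vector field $Y(t)$ (smooth family of $d$-exact 3-forms) along a curve $\varphi(t)$ in $\mathcal M$ with $u=G_\varphi\varphi_t$, $v=G_\varphi Y$, $$D^D_tY=Y_t+d\Big\{\tfrac12[g(\varphi,\varphi_t)\delta v+g(\varphi,Y)\delta u]-\tfrac12\delta[g(\delta u,\delta v)\varphi-\mathrm i_\varphi\mathrm j_{\delta u}\delta v]-\tfrac14[\mathrm i_{\delta v}\mathrm j_\varphi\varphi_t+\mathrm i_{\delta u}\mathrm j_\varphi Y]\Big\}.$$ A smooth path $\varphi(t)$ in $\mathcal M$ is a $D^D$-geodesic if $D^D_t\varphi_t=0$. *)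

theory Defs
  imports
    "HOL-Analysis.Analysis"
    "HOL-Combinatorics.Permutations"
    "HOL-Library.Function_Algebras"
begin

section \<open>Smooth functions on open subsets of Euclidean spaces\<close>

fun ck_on :: "nat \<Rightarrow> 'a::euclidean_space set \<Rightarrow> ('a \<Rightarrow> real) \<Rightarrow> bool" where
  "ck_on 0 S f \<longleftrightarrow> continuous_on S f"
| "ck_on (Suc k) S f \<longleftrightarrow>
     (\<forall>x\<in>S. f differentiable (at x)) \<and>
     (\<forall>b\<in>Basis. ck_on k S (\<lambda>x. frechet_derivative f (at x) b))"

definition smooth_on :: "'a::euclidean_space set \<Rightarrow> ('a \<Rightarrow> real) \<Rightarrow> bool" where
  "smooth_on S f \<longleftrightarrow> (\<forall>k. ck_on k S f)"

section \<open>Oriented smooth 7-manifolds\<close>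

text \<open>
  A chart is a pair of its domain and its coordinate map. A manifold is a Hausdorff type with an
  atlas (not necessarily maximal); second countability is automatic in the compact case.
  Transition maps have positive Jacobian, so the atlas fixes the orientation: every chart is
  positively oriented, with the coordinates ordered as in \<open>idx\<close>.
\<close>

type_synonym 'm chart = "'m set \<times> ('m \<Rightarrow> real ^ 7)"

definition is_chart :: "'m::t2_space chart \<Rightarrow> bool" where
  "is_chart c \<longleftrightarrow> open (fst c) \<and> open (snd c ` fst c) \<and>
     (\<exists>f. homeomorphism (fst c) (snd c ` fst c) (snd c) f)"

text \<open>
  \<open>pdiff c i f p\<close> is the partial derivative of \<open>f\<close> with respect to the \<open>i\<close>-th coordinate of \<open>c\<close> at
  the point \<open>p\<close>; it is \<open>0\<close> by convention off the chart and where \<open>f\<close> is not differentiable.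
\<close>

definition in_coords :: "'m chart \<Rightarrow> ('m \<Rightarrow> real) \<Rightarrow> real ^ 7 \<Rightarrow> real" where
  "in_coords c f = (\<lambda>y. f (inv_into (fst c) (snd c) y))"

definition pdiff :: "'m chart \<Rightarrow> 7 \<Rightarrow> ('m \<Rightarrow> real) \<Rightarrow> 'm \<Rightarrow> real" where
  "pdiff c i f p =
     (if p \<in> fst c \<and> in_coords c f differentiable (at (snd c p))
      then frechet_derivative (in_coords c f) (at (snd c p)) (axis i 1) else 0)"

text \<open>\<open>jac c c' p j i\<close> is the derivative of the \<open>j\<close>-th coordinate of \<open>c\<close> in the \<open>i\<close>-th one of \<open>c'\<close>.\<close>

definition jac :: "'m chart \<Rightarrow> 'm chart \<Rightarrow> 'm \<Rightarrow> 7 \<Rightarrow> 7 \<Rightarrow> real" where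
  "jac c c' p j i = pdiff c' i (\<lambda>q. snd c q $ j) p"

definition oriented_atlas :: "'m::t2_space chart set \<Rightarrow> bool" where
  "oriented_atlas A \<longleftrightarrow>
     (\<forall>c\<in>A. is_chart c) \<and> (\<Union>c\<in>A. fst c) = UNIV \<and>
     (\<forall>c\<in>A. \<forall>c'\<in>A.
        (\<forall>j. smooth_on (snd c' ` (fst c \<inter> fst c')) (in_coords c' (\<lambda>q. snd c q $ j))) \<and>
        (\<forall>p\<in>fst c \<inter> fst c'. det (\<chi> j i. jac c c' p j i) > 0))"

definition compact_oriented_manifold :: "'m::t2_space chart set \<Rightarrow> bool" where
  "compact_oriented_manifold A \<longleftrightarrow> compact (UNIV :: 'm set) \<and> oriented_atlas A"

section \<open>Tensor algebra at a point of a chart\<close>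

text \<open>
  Covariant tensors at a point are given by their components in a chart, indexed by lists of
  coordinate indices: a \<open>(0,k)\<close>-tensor \<open>S\<close> has the components \<open>S [i\<^sub>1, ..., i\<^sub>k]\<close>. A \<open>k\<close>-form is
  identified with the antisymmetric tensor of its components, as in
  \<open>(1 / k!) \<omega> [i\<^sub>1, ..., i\<^sub>k] dx^(i\<^sub>1 ... i\<^sub>k)\<close>.
\<close>

type_synonym comps = "7 list \<Rightarrow> real"

definition multi :: "nat \<Rightarrow> 7 list set" where
  "multi k = {is. length is = k}"

text \<open>The indices in increasing order; note that \<open>7 = 0\<close> in the type \<open>7\<close>.\<close>

definition idx :: "7 list" where
  "idx = [1, 2, 3, 4, 5, 6, 7]"

text \<open>Components of the \<open>k\<close>-form \<open>T [i\<^sub>1, ..., i\<^sub>k] dx^(i\<^sub>1 ... i\<^sub>k)\<close>, where \<open>T\<close> need not be antisymmetric.\<close>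

definition alt :: "nat \<Rightarrow> comps \<Rightarrow> comps" where
  "alt k T is = (if length is = k
     then \<Sum>\<sigma> | \<sigma> permutes {..<k}. of_int (sign \<sigma>) * T (permute_list \<sigma> is) else 0)"

definition wedge :: "nat \<Rightarrow> nat \<Rightarrow> comps \<Rightarrow> comps \<Rightarrow> comps" where
  "wedge p q \<alpha> \<beta> =
     alt (p + q) (\<lambda>is. \<alpha> (take p is) * \<beta> (drop p is) / (fact p * fact q))"

definition contract :: "real ^ 7 \<Rightarrow> comps \<Rightarrow> comps" where
  "contract a \<omega> is = (\<Sum>i\<in>UNIV. a $ i * \<omega> (i # is))"

definition Q_form :: "comps \<Rightarrow> real ^ 7 \<Rightarrow> real ^ 7 \<Rightarrow> comps" where
  "Q_form \<phi> a b = wedge 4 3 (wedge 2 2 (contract a \<phi>) (contract b \<phi>)) \<phi>"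

definition inner_product_pt :: "comps \<Rightarrow> bool" where
  "inner_product_pt g \<longleftrightarrow>
     (\<forall>is. length is \<noteq> 2 \<longrightarrow> g is = 0) \<and> (\<forall>i j. g [i, j] = g [j, i]) \<and>
     (\<forall>a::real ^ 7. a \<noteq> 0 \<longrightarrow> (\<Sum>i\<in>UNIV. \<Sum>j\<in>UNIV. g [i, j] * a $ i * a $ j) > 0)"

definition gmat :: "comps \<Rightarrow> real ^ 7 ^ 7" where
  "gmat g = (\<chi> i j. g [i, j])"

definition ginv :: "comps \<Rightarrow> real ^ 7 ^ 7" where
  "ginv g = matrix_inv (gmat g)"

definition ginvs :: "comps \<Rightarrow> 7 list \<Rightarrow> 7 list \<Rightarrow> real" where
  "ginvs g is js = (\<Prod>n<length is. ginv g $ (is ! n) $ (js ! n))"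

definition ip_pt :: "nat \<Rightarrow> comps \<Rightarrow> comps \<Rightarrow> comps \<Rightarrow> real" where
  "ip_pt k g S S' = (\<Sum>is\<in>multi k. \<Sum>js\<in>multi k. S is * S' js * ginvs g is js) / fact k"

text \<open>The Levi-Civita symbol: the sum has at most one term.\<close>

definition levi_civita :: comps where
  "levi_civita is = (\<Sum>\<pi> | \<pi> permutes (UNIV :: 7 set) \<and> map \<pi> idx = is. of_int (sign \<pi>))"

definition vol_pt :: "comps \<Rightarrow> comps" where
  "vol_pt g is = sqrt (det (gmat g)) * levi_civita is"

text \<open>The convention is \<open>\<alpha> \<and> *\<beta> = g(\<alpha>, \<beta>) vol\<close>.\<close>

definition star_pt :: "nat \<Rightarrow> comps \<Rightarrow> comps \<Rightarrow> comps" where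
  "star_pt k g \<omega> js = (if length js + k = 7
     then (\<Sum>is\<in>multi k. \<Sum>ls\<in>multi k. \<omega> is * ginvs g is ls * vol_pt g (ls @ js)) / fact k
     else 0)"

text \<open>\<open>i_pt p g \<omega> h\<close> and \<open>j_pt p g \<omega> \<eta>\<close> are \<open>i\<^sub>\<omega> h\<close> and \<open>j\<^sub>\<omega> \<eta>\<close> for \<open>p\<close>-forms \<open>\<omega>\<close>, \<open>\<eta>\<close>.\<close>

definition i_pt :: "nat \<Rightarrow> comps \<Rightarrow> comps \<Rightarrow> comps \<Rightarrow> comps" where
  "i_pt p g \<omega> h = alt p (\<lambda>is.
     (\<Sum>l\<in>UNIV. \<Sum>s\<in>UNIV. h [hd is, l] * ginv g $ l $ s * \<omega> (s # tl is)) / fact (p - 1))"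

definition j_pt :: "nat \<Rightarrow> comps \<Rightarrow> comps \<Rightarrow> comps \<Rightarrow> comps" where
  "j_pt p g \<omega> \<eta> is = (if length is = 2
     then (\<Sum>as\<in>multi (p - 1). \<Sum>bs\<in>multi (p - 1). ginvs g as bs *
            (\<omega> (is ! 0 # as) * \<eta> (is ! 1 # bs) + \<omega> (is ! 1 # as) * \<eta> (is ! 0 # bs))) / 2
     else 0)"

section \<open>Tensor fields and differential forms\<close>

text \<open>
  A tensor field is the family of its components in all charts of the atlas; components are \<open>0\<close>
  where they have no meaning, so that equality of fields is equality of functions.
\<close>

type_synonym 'm tfield = "'m chart \<Rightarrow> 'm \<Rightarrow> comps"
type_synonym 'm sfield = "'m chart \<Rightarrow> 'm \<Rightarrow> real"

definition tensor_field :: "'m::t2_space chart set \<Rightarrow> nat \<Rightarrow> 'm tfield \<Rightarrow> bool" where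
  "tensor_field A k S \<longleftrightarrow>
     (\<forall>c p is. c \<notin> A \<or> p \<notin> fst c \<or> length is \<noteq> k \<longrightarrow> S c p is = 0) \<and>
     (\<forall>c\<in>A. \<forall>is. smooth_on (snd c ` fst c) (in_coords c (\<lambda>p. S c p is))) \<and>
     (\<forall>c\<in>A. \<forall>c'\<in>A. \<forall>p\<in>fst c \<inter> fst c'. \<forall>is\<in>multi k.
        S c' p is = (\<Sum>js\<in>multi k. (\<Prod>n<k. jac c c' p (js ! n) (is ! n)) * S c p js))"

definition forms :: "'m::t2_space chart set \<Rightarrow> nat \<Rightarrow> 'm tfield set" where
  "forms A k = {\<omega>. tensor_field A k \<omega> \<and>
     (\<forall>c p. \<forall>is\<in>multi k. \<forall>\<sigma>. \<sigma> permutes {..<k} \<longrightarrow>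
        \<omega> c p (permute_list \<sigma> is) = of_int (sign \<sigma>) * \<omega> c p is)}"

definition fmult :: "'m sfield \<Rightarrow> 'm tfield \<Rightarrow> 'm tfield" (infixr "\<cdot>" 72) where
  "f \<cdot> \<omega> = (\<lambda>c p is. f c p * \<omega> c p is)"

definition cmult :: "real \<Rightarrow> 'm tfield \<Rightarrow> 'm tfield" (infixr "\<odot>" 72) where
  "r \<odot> \<omega> = (\<lambda>c p is. r * \<omega> c p is)"

definition ip :: "nat \<Rightarrow> 'm tfield \<Rightarrow> 'm tfield \<Rightarrow> 'm tfield \<Rightarrow> 'm sfield" where
  "ip k g S S' c p = ip_pt k (g c p) (S c p) (S' c p)"

definition star :: "nat \<Rightarrow> 'm tfield \<Rightarrow> 'm tfield \<Rightarrow> 'm tfield" where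
  "star k g \<omega> c p = star_pt k (g c p) (\<omega> c p)"

definition i_op :: "nat \<Rightarrow> 'm tfield \<Rightarrow> 'm tfield \<Rightarrow> 'm tfield \<Rightarrow> 'm tfield" where
  "i_op k g \<omega> h c p = i_pt k (g c p) (\<omega> c p) (h c p)"

definition j_op :: "nat \<Rightarrow> 'm tfield \<Rightarrow> 'm tfield \<Rightarrow> 'm tfield \<Rightarrow> 'm tfield" where
  "j_op k g \<omega> \<eta> c p = j_pt k (g c p) (\<omega> c p) (\<eta> c p)"

definition ext_d :: "'m tfield \<Rightarrow> 'm tfield" where
  "ext_d \<omega> c p is = (\<Sum>n<length is.
     (- 1) ^ n * pdiff c (is ! n) (\<lambda>q. \<omega> c q (take n is @ drop (Suc n) is)) p)"

text \<open>The first argument of \<open>codiff\<close> and \<open>laplacian\<close> is the degree of the form they act on.\<close>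

definition codiff :: "nat \<Rightarrow> 'm tfield \<Rightarrow> 'm tfield \<Rightarrow> 'm tfield" where
  "codiff k g \<omega> = (- 1) ^ k \<odot> star (8 - k) g (ext_d (star k g \<omega>))"

definition laplacian :: "nat \<Rightarrow> 'm tfield \<Rightarrow> 'm tfield \<Rightarrow> 'm tfield" where
  "laplacian k g \<omega> = ext_d (codiff k g \<omega>) + codiff (Suc k) g (ext_d \<omega>)"

definition closed_forms :: "'m::t2_space chart set \<Rightarrow> nat \<Rightarrow> 'm tfield set" where
  "closed_forms A k = {\<omega> \<in> forms A k. ext_d \<omega> = 0}"

text \<open>The \<open>d\<close>-exact forms, in degrees \<open>k \<ge> 1\<close>.\<close>

definition exact_forms :: "'m::t2_space chart set \<Rightarrow> nat \<Rightarrow> 'm tfield set" where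
  "exact_forms A k = ext_d ` forms A (k - 1)"

definition de_rham :: "'m::t2_space chart set \<Rightarrow> nat \<Rightarrow> 'm tfield set set" where
  "de_rham A k = closed_forms A k //
     {(\<alpha>, \<beta>). \<alpha> \<in> closed_forms A k \<and> \<beta> \<in> closed_forms A k \<and> \<alpha> - \<beta> \<in> exact_forms A k}"

section \<open>\<open>G\<^sub>2\<close>-structures\<close>

text \<open>
  A \<open>7\<close>-form is positive if its component at \<open>idx\<close> is positive in the (positively oriented) charts
  of the atlas.
\<close>

definition positive_form :: "'m::t2_space chart set \<Rightarrow> 'm tfield \<Rightarrow> bool" where
  "positive_form A \<phi> \<longleftrightarrow> \<phi> \<in> forms A 3 \<and>
     (\<forall>c\<in>A. \<forall>p\<in>fst c. \<forall>a. a \<noteq> 0 \<longrightarrow> Q_form (\<phi> c p) a a idx > 0)"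

text \<open>
  The equation \<open>6 g = *Q\<^sub>\<phi>\<close> is pointwise, and so is the definition of its unique solution among the
  inner products. Off the chart, where \<open>\<phi>\<close> is \<open>0\<close>, the value is irrelevant.
\<close>

definition g2_pt :: "comps \<Rightarrow> comps" where
  "g2_pt \<phi> = (THE g. inner_product_pt g \<and>
     (\<forall>i j. 6 * g [i, j] = star_pt 7 g (Q_form \<phi> (axis i 1) (axis j 1)) []))"

definition g2_metric :: "'m tfield \<Rightarrow> 'm tfield" where
  "g2_metric \<phi> c p = g2_pt (\<phi> c p)"

definition moduli :: "'m::t2_space chart set \<Rightarrow> 'm tfield set \<Rightarrow> 'm tfield set" where
  "moduli A C = {\<phi>. \<phi> \<in> closed_forms A 3 \<and> positive_form A \<phi> \<and> \<phi> \<in> C}"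

text \<open>
  \<open>G\<close> is the operator \<open>(\<phi>, X) \<mapsto> G\<^sub>\<phi> X\<close>: for \<open>\<phi>\<close> in the moduli space and \<open>X\<close> exact, \<open>G \<phi> X\<close> is the
  unique exact solution \<open>w\<close> of \<open>\<Delta>\<^sub>\<phi> w = X\<close>. Elsewhere its values are irrelevant.
\<close>

definition green_operator ::
  "'m::t2_space chart set \<Rightarrow> 'm tfield set \<Rightarrow> ('m tfield \<Rightarrow> 'm tfield \<Rightarrow> 'm tfield) \<Rightarrow> bool" where
  "green_operator A C G \<longleftrightarrow>
     (\<forall>\<phi>\<in>moduli A C. \<forall>X\<in>exact_forms A 3. \<forall>w.
        (w \<in> exact_forms A 3 \<and> laplacian 3 (g2_metric \<phi>) w = X) \<longleftrightarrow> w = G \<phi> X)"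

section \<open>Paths in the moduli space and the Dirichlet connection\<close>

definition time_deriv :: "(real \<Rightarrow> 'm tfield) \<Rightarrow> real \<Rightarrow> 'm tfield" where
  "time_deriv Y t = (\<lambda>c p is. deriv (\<lambda>s. Y s c p is) t)"

definition smooth_family :: "'m::t2_space chart set \<Rightarrow> real set \<Rightarrow> (real \<Rightarrow> 'm tfield) \<Rightarrow> bool" where
  "smooth_family A J Y \<longleftrightarrow> (\<forall>c\<in>A. \<forall>is.
     smooth_on (J \<times> snd c ` fst c) (\<lambda>(t, y). in_coords c (\<lambda>p. Y t c p is) y))"

text \<open>
  The moduli space is open in an affine space over \<open>d\<Omega>\<^sup>2(M)\<close>, so the velocity of a smooth path is a
  smooth family of exact forms; joint smoothness in time and space is expressed in charts.
\<close>

definition smooth_path ::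
  "'m::t2_space chart set \<Rightarrow> 'm tfield set \<Rightarrow> real set \<Rightarrow> (real \<Rightarrow> 'm tfield) \<Rightarrow> bool" where
  "smooth_path A C J \<phi> \<longleftrightarrow> smooth_family A J \<phi> \<and>
     (\<forall>t\<in>J. \<phi> t \<in> moduli A C \<and> time_deriv \<phi> t \<in> exact_forms A 3)"

text \<open>
  \<open>dirichlet_D G \<phi> Y t\<close> is the covariant derivative at time \<open>t\<close> of the vector field \<open>Y\<close> along the
  path \<open>\<phi>\<close>, for the Levi-Civita connection of the Dirichlet metric.
\<close>

definition dirichlet_D ::
  "('m tfield \<Rightarrow> 'm tfield \<Rightarrow> 'm tfield) \<Rightarrow>
   (real \<Rightarrow> 'm tfield) \<Rightarrow> (real \<Rightarrow> 'm tfield) \<Rightarrow> real \<Rightarrow> 'm tfield" where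
  "dirichlet_D G \<phi> Y t =
    (let g = g2_metric (\<phi> t); \<phi>\<^sub>t = time_deriv \<phi> t;
         u = G (\<phi> t) \<phi>\<^sub>t; v = G (\<phi> t) (Y t);
         \<delta>u = codiff 3 g u; \<delta>v = codiff 3 g v
     in time_deriv Y t + ext_d (
          (1/2) \<odot> (ip 3 g (\<phi> t) \<phi>\<^sub>t \<cdot> \<delta>v + ip 3 g (\<phi> t) (Y t) \<cdot> \<delta>u)
          - (1/2) \<odot> codiff 3 g (ip 2 g \<delta>u \<delta>v \<cdot> \<phi> t - i_op 3 g (\<phi> t) (j_op 2 g \<delta>u \<delta>v))
          - (1/4) \<odot> (i_op 2 g \<delta>v (j_op 3 g (\<phi> t) \<phi>\<^sub>t) + i_op 2 g \<delta>u (j_op 3 g (\<phi> t) (Y t)))))"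

definition dirichlet_geodesic ::
  "'m::t2_space chart set \<Rightarrow> 'm tfield set \<Rightarrow> ('m tfield \<Rightarrow> 'm tfield \<Rightarrow> 'm tfield) \<Rightarrow>
   real set \<Rightarrow> (real \<Rightarrow> 'm tfield) \<Rightarrow> bool" where
  "dirichlet_geodesic A C G J \<phi> \<longleftrightarrow> smooth_path A C J \<phi> \<and>
     (\<forall>t\<in>J. dirichlet_D G \<phi> (time_deriv \<phi>) t = 0)"

end

theory Submission
  imports Defs
begin

text \<open>
  The first equation is the definition of \<open>G\<close>. The second is the geodesic equation with both
  arguments of the connection equal to \<open>\<phi>\<^sub>t\<close>, except that the inner product of \<open>\<phi>\<close> and \<open>\<phi>\<^sub>t\<close> appears
  in the opposite order. Its symmetry needs that of the metric, hence that \<open>6 g = *Q\<^sub>\<phi>\<close> has a unique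
  solution among the inner products, since \<open>g2_pt\<close> selects it by \<open>THE\<close>: the right-hand side is the
  matrix \<open>B\<close> of \<open>Q\<^sub>\<phi>\<close> divided by \<open>sqrt (det g)\<close>, so that \<open>g\<close> is a positive multiple of \<open>B\<close>, and the
  determinant fixes the factor.
\<close>

section \<open>The index list \<open>idx\<close> and sums over multi-indices\<close>

lemma length_idx [simp]: "length idx = 7"
  by (simp add: idx_def)

lemma distinct_idx: "distinct idx"
  by (simp add: idx_def)

lemma set_idx: "set idx = UNIV"
proof (rule card_subset_eq)
  show "card (set idx) = card (UNIV :: 7 set)"
    using distinct_card[OF distinct_idx] by simp
qed auto

lemma bij_betw_nth_idx: "bij_betw ((!) idx) {..<7} UNIV"
  by (rule bij_betw_nth) (auto simp: distinct_idx set_idx)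

lemma map_idx_in_multi [simp]: "map f idx \<in> multi 7"
  by (simp add: multi_def)

text \<open>Lists of seven indices are encoded as self-maps of the index type, so that the
  permutations occurring in determinants can be singled out among them.\<close>

lemma bij_betw_map_idx: "bij_betw (\<lambda>f. map f idx) UNIV (multi 7)"
proof (rule bij_betwI')
  show "\<exists>f\<in>UNIV. is = map f idx" if "is \<in> multi 7" for "is"
  proof (rule bexI)
    have "length is = length idx"
      using that by (simp add: multi_def)
    then show "is = map (the \<circ> map_of (zip idx is)) idx"
      by (intro nth_equalityI) (auto simp: map_of_zip_nth distinct_idx)
  qed simp
qed (auto simp: multi_def set_idx)

lemma finite_multi [simp]: "finite (multi k)"
  using finite_lists_length_eq[of "UNIV :: 7 set" k] by (simp add: multi_def)

text \<open>Only rearrangements of \<open>idx\<close> survive the symbol, which gives the sum the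
  shape of the Leibniz formula for a determinant.\<close>

lemma sum_levi_civita:
  "(\<Sum>ls\<in>multi 7. H ls * levi_civita ls) =
     (\<Sum>\<pi> | \<pi> permutes UNIV. of_int (sign \<pi>) * H (map \<pi> idx))"
proof -
  have "(\<Sum>ls\<in>multi 7. H ls * levi_civita ls) =
      (\<Sum>ls\<in>multi 7. \<Sum>\<pi> | \<pi> permutes UNIV. if map \<pi> idx = ls then of_int (sign \<pi>) * H ls else 0)"
    unfolding levi_civita_def sum_distrib_left
    by (intro sum.cong refl sum.mono_neutral_cong_left) auto
  also have "\<dots> = (\<Sum>\<pi> | \<pi> permutes UNIV. \<Sum>ls\<in>multi 7. if map \<pi> idx = ls then of_int (sign \<pi>) * H ls else 0)"
    by (rule sum.swap)
  also have "\<dots> = (\<Sum>\<pi> | \<pi> permutes UNIV. of_int (sign \<pi>) * H (map \<pi> idx))"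
    by (intro sum.cong refl, subst sum.delta') simp_all
  finally show ?thesis .
qed

lemma ginvs_map_idx: "ginvs g (map f idx) (map h idx) = (\<Prod>i\<in>UNIV. ginv g $ f i $ h i)"
  unfolding ginvs_def
  using prod.reindex_bij_betw[OF bij_betw_nth_idx, of "\<lambda>i. ginv g $ f i $ h i"] by simp

section \<open>Antisymmetrisation\<close>

text \<open>Composing the summation variable with \<open>\<tau>\<close> on the left reindexes the
  sum; the factor \<open>sign \<tau>\<close> that appears is its own inverse.\<close>

lemma alt_permute_list:
  assumes "\<tau> permutes {..<k}" "length is = k"
  shows "alt k T (permute_list \<tau> is) = of_int (sign \<tau>) * alt k T is"
proof -
  have "alt k T is = (\<Sum>\<sigma> | \<sigma> permutes {..<k}. of_int (sign (\<tau> \<circ> \<sigma>)) * T (permute_list (\<tau> \<circ> \<sigma>) is))"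
    using assms(2) by (simp add: alt_def) (subst setum_permutations_compose_left[OF assms(1)], simp)
  also have "\<dots> = (\<Sum>\<sigma> | \<sigma> permutes {..<k}.
      of_int (sign \<tau>) * (of_int (sign \<sigma>) * T (permute_list \<sigma> (permute_list \<tau> is))))"
    using assms
    by (intro sum.cong refl)
      (auto simp: permute_list_compose sign_compose permutes_imp_permutation[of "{..<k}"])
  also have "\<dots> = of_int (sign \<tau>) * alt k T (permute_list \<tau> is)"
    using assms by (simp add: alt_def sum_distrib_left)
  finally show ?thesis
    by (simp flip: mult.assoc of_int_mult)
qed

text \<open>Permuting inside the argument amounts to composing on the right instead. This is what
  commutes the factors of a wedge product.\<close>

lemma alt_permute_arg:
  assumes "\<tau> permutes {..<k}"
  shows "alt k (\<lambda>is. T (permute_list \<tau> is)) is = of_int (sign \<tau>) * alt k T is"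
proof (cases "length is = k")
  case True
  have "alt k T is = (\<Sum>\<sigma> | \<sigma> permutes {..<k}. of_int (sign (\<sigma> \<circ> \<tau>)) * T (permute_list (\<sigma> \<circ> \<tau>) is))"
    using True by (simp add: alt_def) (subst sum_permutations_compose_right[OF assms], simp)
  also have "\<dots> = (\<Sum>\<sigma> | \<sigma> permutes {..<k}.
      of_int (sign \<tau>) * (of_int (sign \<sigma>) * T (permute_list \<tau> (permute_list \<sigma> is))))"
    using assms True
    by (intro sum.cong refl)
      (auto simp: permute_list_compose sign_compose permutes_imp_permutation[of "{..<k}"])
  also have "\<dots> = of_int (sign \<tau>) * alt k (\<lambda>is. T (permute_list \<tau> is)) is"
    using True by (simp add: alt_def sum_distrib_left)
  finally show ?thesis
    by (simp flip: mult.assoc of_int_mult)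
qed (simp add: alt_def)

text \<open>Here \<open>\<pi>\<close> acts on indices, whereas \<open>alt\<close> permutes
  positions. Transporting \<open>\<pi>\<close> along the position map \<open>e\<close> keeps its
  sign and reduces the claim to \<open>alt_permute_list\<close>.\<close>

lemma alt_map_idx:
  assumes "\<pi> permutes UNIV"
  shows "alt 7 T (map \<pi> idx) = of_int (sign \<pi>) * alt 7 T idx"
proof -
  define e where "e = inv_into {..<7} ((!) idx)"
  have inj: "inj_on e UNIV" and im: "bij_betw e UNIV {..<7}"
    using bij_betw_inv_into[OF bij_betw_nth_idx] by (auto simp: e_def bij_betw_def)
  have idx_e: "idx ! e i = i" for i
    unfolding e_def using bij_betw_nth_idx by (simp add: bij_betw_inv_into_right)
  have e_idx: "e (idx ! n) = n" if "n < 7" for n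
    unfolding e_def using bij_betw_nth_idx that by (simp add: bij_betw_inv_into_left)
  define \<tau> where "\<tau> = map_permutation UNIV e \<pi>"
  have \<tau>: "\<tau> permutes {..<7}"
    unfolding \<tau>_def using im assms by (rule map_permutation_permutes)
  have "map \<pi> idx = permute_list \<tau> idx"
  proof (rule nth_equalityI)
    fix n assume "n < length (map \<pi> idx)"
    then have n: "n < 7" by simp
    have "\<tau> n = e (\<pi> (idx ! n))"
      using map_permutation_apply[OF inj, of "idx ! n" \<pi>] e_idx[OF n] by (simp add: \<tau>_def)
    then show "map \<pi> idx ! n = permute_list \<tau> idx ! n"
      using \<tau> n by (simp add: permute_list_nth idx_e)
  qed simp
  moreover have "sign \<tau> = sign \<pi>"
    unfolding \<tau>_def using inj assms by (intro sign_map_permutation) auto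
  ultimately show ?thesis
    using alt_permute_list[OF \<tau>, of idx T] by simp
qed

section \<open>The Hodge star in top degree\<close>

text \<open>Summing the symbol against the inverse metric gives a determinant with rows selected by
  \<open>f\<close>. It vanishes unless \<open>f\<close> is a permutation, and the \<open>7!\<close>
  permutations contribute equally, which cancels the factorial in \<open>star_pt\<close>.\<close>

lemma star_alt_7:
  "star_pt 7 g (alt 7 T) [] = alt 7 T idx * (sqrt (det (gmat g)) * det (ginv g))"
proof -
  define M where "M = ginv g"
  have inner: "(\<Sum>ls\<in>multi 7. ginvs g (map f idx) ls * levi_civita ls) = det (\<chi> i. M $ f i)" for f
    unfolding sum_levi_civita ginvs_map_idx det_def M_def by simp
  have "(\<Sum>is\<in>multi 7. \<Sum>ls\<in>multi 7. alt 7 T is * ginvs g is ls * levi_civita ls) =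
      (\<Sum>f\<in>UNIV. alt 7 T (map f idx) * (\<Sum>ls\<in>multi 7. ginvs g (map f idx) ls * levi_civita ls))"
    by (subst sum.reindex_bij_betw[OF bij_betw_map_idx, symmetric])
      (simp add: sum_distrib_left mult.assoc)
  also have "\<dots> = (\<Sum>f\<in>UNIV. alt 7 T (map f idx) * det (\<chi> i. M $ f i))"
    by (simp add: inner)
  also have "\<dots> = (\<Sum>f | f permutes UNIV. alt 7 T (map f idx) * det (\<chi> i. M $ f i))"
  proof (rule sum.mono_neutral_right)
    show "\<forall>f\<in>UNIV - {f. f permutes UNIV}. alt 7 T (map f idx) * det (\<chi> i. M $ f i) = 0"
    proof
      fix f :: "7 \<Rightarrow> 7" assume "f \<in> UNIV - {f. f permutes UNIV}"
      then have "\<not> inj f"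
        using finite_UNIV_inj_surj[of f] by (auto intro: bij_imp_permutes simp: bij_def)
      then obtain i j where "i \<noteq> j" "f i = f j"
        by (auto simp: inj_def)
      then have "det (\<chi> i. M $ f i) = 0"
        by (intro det_identical_rows[of i j]) (auto simp: row_def)
      then show "alt 7 T (map f idx) * det (\<chi> i. M $ f i) = 0" by simp
    qed
  qed auto
  \<comment> \<open>The sign from \<open>alt\<close> and the sign from permuting the rows multiply
    to 1.\<close>
  also have "\<dots> = (\<Sum>f | f permutes (UNIV :: 7 set). alt 7 T idx * det M)"
    by (intro sum.cong refl)
      (auto simp: alt_map_idx det_permute_rows simp flip: of_int_mult mult.assoc)
  also have "\<dots> = fact 7 * (alt 7 T idx * det M)"
    using card_permutations[OF refl, of "UNIV :: 7 set"] by simp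
  finally have total: "(\<Sum>is\<in>multi 7. \<Sum>ls\<in>multi 7. alt 7 T is * ginvs g is ls * levi_civita ls) =
      fact 7 * (alt 7 T idx * det M)" .
  have "star_pt 7 g (alt 7 T) [] = sqrt (det (gmat g)) *
      (\<Sum>is\<in>multi 7. \<Sum>ls\<in>multi 7. alt 7 T is * ginvs g is ls * levi_civita ls) / fact 7"
    by (simp add: star_pt_def vol_pt_def sum_distrib_left mult_ac)
  also have "\<dots> = alt 7 T idx * (sqrt (det (gmat g)) * det (ginv g))"
    unfolding total M_def by simp
  finally show ?thesis .
qed

section \<open>The bilinear form \<open>Q_form\<close> and its matrix\<close>

lemma alt_linear_sum:
  "alt k (\<lambda>is. \<Sum>i\<in>I. c i * T i is) is = (\<Sum>i\<in>I. c i * alt k (T i) is)"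
proof (cases "length is = k")
  case True
  then have "alt k (\<lambda>is. \<Sum>i\<in>I. c i * T i is) is =
      (\<Sum>\<sigma> | \<sigma> permutes {..<k}. \<Sum>i\<in>I. c i * (of_int (sign \<sigma>) * T i (permute_list \<sigma> is)))"
    by (simp add: alt_def sum_distrib_left mult.left_commute)
  also have "\<dots> = (\<Sum>i\<in>I. \<Sum>\<sigma> | \<sigma> permutes {..<k}. c i * (of_int (sign \<sigma>) * T i (permute_list \<sigma> is)))"
    by (rule sum.swap)
  finally show ?thesis
    using True by (simp add: alt_def sum_distrib_left)
qed (simp add: alt_def)

lemma wedge_linear_sum_left:
  "wedge p q (\<lambda>is. \<Sum>i\<in>I. c i * \<alpha> i is) \<beta> = (\<lambda>is. \<Sum>i\<in>I. c i * wedge p q (\<alpha> i) \<beta> is)"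
  unfolding wedge_def alt_linear_sum[symmetric]
  by (simp add: sum_distrib_right sum_divide_distrib mult.assoc)

text \<open>Exchanging two blocks of length two is an even permutation of the four
  positions.\<close>

lemma wedge_2_2_commute: "wedge 2 2 \<alpha> \<beta> = wedge 2 2 \<beta> \<alpha>"
proof
  fix "is" :: "7 list"
  define \<tau> :: "nat \<Rightarrow> nat" where "\<tau> = Transposition.transpose 0 2 \<circ> Transposition.transpose 1 3"
  have perm: "\<tau> permutes {..<4}"
    unfolding \<tau>_def by (intro permutes_compose permutes_swap_id) auto
  have sgn: "sign \<tau> = 1"
    unfolding \<tau>_def by (subst sign_compose) (auto simp: permutation_swap_id sign_swap_id)
  show "wedge 2 2 \<alpha> \<beta> is = wedge 2 2 \<beta> \<alpha> is"
  proof (cases "length is = 4")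
    case True
    define T where "T = (\<lambda>is. \<alpha> (take 2 is) * \<beta> (drop 2 is) / (fact 2 * fact 2 :: real))"
    have swap: "T (permute_list \<tau> js) = \<beta> (take 2 js) * \<alpha> (drop 2 js) / (fact 2 * fact 2)"
      if js: "length js = 4" for js
    proof -
      obtain a b c d where "js = [a, b, c, d]"
        using js by (auto simp: numeral_eq_Suc length_Suc_conv)
      then show ?thesis
        by (simp add: T_def permute_list_def \<tau>_def Transposition.transpose_def upt_rec)
    qed
    have "wedge 2 2 \<alpha> \<beta> is = alt 4 (\<lambda>is. T (permute_list \<tau> is)) is"
      using alt_permute_arg[OF perm, of T "is"] by (simp add: sgn wedge_def T_def)
    also have "\<dots> = wedge 2 2 \<beta> \<alpha> is"
      using True by (simp add: wedge_def alt_def swap)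
    finally show ?thesis .
  qed (simp add: wedge_def alt_def)
qed

lemma Q_form_commute: "Q_form \<phi> a b = Q_form \<phi> b a"
  unfolding Q_form_def by (simp only: wedge_2_2_commute[of "contract a \<phi>"])

text \<open>The contraction is linear in the vector, and both nested wedge products are linear in
  their left factor.\<close>

lemma Q_form_linear_left:
  "Q_form \<phi> a b is = (\<Sum>i\<in>UNIV. a $ i * Q_form \<phi> (axis i 1) b is)"
proof -
  have axis: "contract (axis i 1) \<phi> = (\<lambda>is. \<phi> (i # is))" for i
    by (auto simp: contract_def axis_def if_distrib[of "\<lambda>x. x * _"] cong: if_cong)
  have "contract a \<phi> = (\<lambda>is. \<Sum>i\<in>UNIV. a $ i * contract (axis i 1) \<phi> is)"
    unfolding axis by (simp add: contract_def fun_eq_iff)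
  then show ?thesis
    by (simp add: Q_form_def wedge_linear_sum_left)
qed

text \<open>The matrix \<open>B\<close> of the overview: the component at \<open>idx\<close> is the
  coefficient of a 7-form with respect to the coordinate volume form.\<close>

definition Q_mat :: "comps \<Rightarrow> real ^ 7 ^ 7" where
  "Q_mat \<phi> = (\<chi> i j. Q_form \<phi> (axis i 1) (axis j 1) idx)"

lemma transpose_Q_mat: "transpose (Q_mat \<phi>) = Q_mat \<phi>"
  by (simp add: Q_mat_def transpose_def Q_form_commute)

text \<open>Left linearity is used once for each slot, with symmetry exchanging the slots. The
  result turns positivity of a 3-form into positive definiteness of \<open>Q_mat\<close>.\<close>

lemma inner_Q_mat: "a \<bullet> (Q_mat \<phi> *v b) = Q_form \<phi> a b idx"
proof -
  have "Q_form \<phi> a b idx = (\<Sum>i\<in>UNIV. a $ i * Q_form \<phi> b (axis i 1) idx)"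
    by (subst Q_form_linear_left) (simp add: Q_form_commute)
  also have "\<dots> = (\<Sum>i\<in>UNIV. a $ i * (\<Sum>j\<in>UNIV. b $ j * Q_form \<phi> (axis j 1) (axis i 1) idx))"
    by (subst Q_form_linear_left) (rule refl)
  also have "\<dots> = (\<Sum>i\<in>UNIV. a $ i * (\<Sum>j\<in>UNIV. b $ j * Q_form \<phi> (axis i 1) (axis j 1) idx))"
    by (subst Q_form_commute) (rule refl)
  also have "\<dots> = a \<bullet> (Q_mat \<phi> *v b)"
    by (simp add: inner_vec_def matrix_vector_mult_def Q_mat_def mult.commute)
  finally show ?thesis ..
qed

text \<open>The outer wedge product is an antisymmetrisation in degree 7, so
  \<open>star_alt_7\<close> applies. The metric enters only through a scalar independent of
  \<open>i\<close> and \<open>j\<close>.\<close>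

lemma star_Q_form:
  "star_pt 7 g (Q_form \<phi> (axis i 1) (axis j 1)) [] =
     Q_mat \<phi> $ i $ j * (sqrt (det (gmat g)) * det (ginv g))"
  unfolding Q_form_def Q_mat_def wedge_def by (simp add: star_alt_7)

section \<open>Positive definite matrices, determinants and inverses\<close>

definition posdef :: "real ^ 'n ^ 'n \<Rightarrow> bool" where
  "posdef B \<longleftrightarrow> (\<forall>a. a \<noteq> 0 \<longrightarrow> a \<bullet> (B *v a) > 0)"

lemma posdef_det_nz:
  fixes B :: "real ^ 'n ^ 'n"
  assumes "posdef B"
  shows "det B \<noteq> 0"
proof -
  have "\<forall>x. B *v x = 0 \<longrightarrow> x = 0"
    using assms unfolding posdef_def by (metis inner_zero_right less_irrefl)
  then show ?thesis
    by (simp add: invertible_det_nz[symmetric] invertible_left_inverse matrix_left_invertible_ker)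
qed

lemma posdef_det_pos:
  fixes B :: "real ^ 'n ^ 'n"
  assumes "posdef B"
  shows "det B > 0"
proof (rule ccontr)
  \<comment> \<open>The determinant does not vanish on the segment from the identity to \<open>B\<close>.\<close>
  define F where "F = (\<lambda>t. (1 - t) *\<^sub>R mat 1 + t *\<^sub>R B)"
  assume "\<not> det B > 0"
  moreover have "continuous_on {0..1} (\<lambda>t. det (F t))"
    unfolding det_def F_def by (intro continuous_intros)
  ultimately obtain t where t: "0 \<le> t" "t \<le> 1" "det (F t) = 0"
    using IVT2'[of "\<lambda>t. det (F t)" 1 0 0] by (auto simp: F_def)
  have "posdef (F t)"
    unfolding posdef_def
  proof (intro allI impI)
    fix a :: "real ^ 'n" assume "a \<noteq> 0"
    then have pos: "a \<bullet> a > 0" "a \<bullet> (B *v a) > 0"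
      using assms by (auto simp: posdef_def)
    have "a \<bullet> (F t *v a) = (1 - t) * (a \<bullet> a) + t * (a \<bullet> (B *v a))"
      by (simp add: F_def matrix_vector_mult_add_rdistrib scaleR_matrix_vector_assoc[symmetric] inner_add_right)
    also have "\<dots> > 0"
    \<comment> \<open>For \<open>t < 1\<close> the first summand is strictly positive; at
      \<open>t = 1\<close> it vanishes and the second one is.\<close>
    proof (cases "t = 1")
      case False
      then show ?thesis using t pos by (intro add_pos_nonneg) auto
    qed (use pos in simp)
    finally show "a \<bullet> (F t *v a) > 0" .
  qed
  with t show False by (simp add: posdef_det_nz)
qed

lemma matrix_inv_props:
  assumes "invertible A"
  shows "A ** matrix_inv A = mat 1" "matrix_inv A ** A = mat 1"
  using someI_ex[OF assms[unfolded invertible_def]] unfolding matrix_inv_def by auto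

text \<open>The transposed inverse is a left inverse of the symmetric matrix, hence equal to its
  right inverse.\<close>

lemma transpose_matrix_inv:
  fixes A :: "real ^ 'n ^ 'n"
  assumes "invertible A" "transpose A = A"
  shows "transpose (matrix_inv A) = matrix_inv A"
proof -
  have "transpose (matrix_inv A) ** A = mat 1"
    using matrix_inv_props(1)[OF assms(1)] assms(2)
    by (metis matrix_transpose_mul transpose_mat)
  then show ?thesis
    using matrix_inv_props(1)[OF assms(1)]
    by (metis matrix_mul_assoc matrix_mul_lid matrix_mul_rid)
qed

lemma det_scaleR:
  fixes B :: "real ^ 'n ^ 'n"
  shows "det (s *\<^sub>R B) = s ^ CARD('n) * det B"
  by (simp add: det_def prod.distrib sum_distrib_left mult.left_commute)

section \<open>Existence and uniqueness of the metric of a positive 3-form\<close>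

lemma inner_product_pt_iff:
  "inner_product_pt g \<longleftrightarrow>
     (\<forall>is. length is \<noteq> 2 \<longrightarrow> g is = 0) \<and> transpose (gmat g) = gmat g \<and> posdef (gmat g)"
proof -
  have "a \<bullet> (gmat g *v a) = (\<Sum>i\<in>UNIV. \<Sum>j\<in>UNIV. g [i, j] * a $ i * a $ j)" for a
    by (simp add: inner_vec_def matrix_vector_mult_def gmat_def sum_distrib_left algebra_simps)
  moreover have "(transpose (gmat g) = gmat g) = (\<forall>i j. g [i, j] = g [j, i])"
    by (auto simp: transpose_def gmat_def vec_eq_iff)
  ultimately show ?thesis
    by (simp add: inner_product_pt_def posdef_def)
qed

text \<open>Since \<open>det (ginv g)\<close> is the reciprocal of \<open>det (gmat g)\<close>, the
  scalar in \<open>star_Q_form\<close> is the reciprocal of the volume density.\<close>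

lemma vol_factor:
  assumes "posdef (gmat g)"
  shows "sqrt (det (gmat g)) * det (ginv g) = 1 / sqrt (det (gmat g))"
proof -
  have pos: "det (gmat g) > 0"
    using assms by (rule posdef_det_pos)
  then have "invertible (gmat g)"
    by (simp add: invertible_det_nz)
  then have "det (gmat g) * det (ginv g) = 1"
    using matrix_inv_props(1) unfolding ginv_def by (metis det_I det_mul)
  then have "det (ginv g) = 1 / det (gmat g)"
    using pos by (simp add: field_simps)
  then show ?thesis
    using pos by (simp add: real_div_sqrt field_simps)
qed

text \<open>
  Put \<open>g = s Q_mat \<phi>\<close> in \<open>6 g sqrt (det g) = Q_mat \<phi>\<close>: then \<open>36 s^9 det (Q_mat \<phi>) = 1\<close>.
\<close>

lemma g2_equation_iff:
  assumes "posdef (Q_mat \<phi>)" "posdef (gmat g)"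
  shows "(\<forall>i j. 6 * g [i, j] = star_pt 7 g (Q_form \<phi> (axis i 1) (axis j 1)) []) \<longleftrightarrow>
    gmat g = root 9 (1 / (36 * det (Q_mat \<phi>))) *\<^sub>R Q_mat \<phi>" (is "?L \<longleftrightarrow> gmat g = ?r *\<^sub>R _")
proof -
  define B where "B = Q_mat \<phi>"
  define D where "D = det (gmat g)"
  have D: "D > 0" and B: "det B > 0"
    using assms by (auto simp: D_def B_def posdef_det_pos)
  have r: "?r > 0" "36 * ?r ^ 9 * det B = 1"
    using B by (auto simp: B_def real_root_pow_pos)
  \<comment> \<open>In dimension 7, \<open>det (s *\<^sub>R B)\<close> is
    \<open>s ^ 7 * det B\<close>; the square of \<open>6 * s\<close> supplies the other two
    powers.\<close>
  have key: "36 * s ^ 9 * det B = (6 * s * sqrt (det (s *\<^sub>R B)))\<^sup>2" if "s > 0" for s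
    using that B by (simp add: det_scaleR power_mult_distrib algebra_simps power_numeral_reduce power2_eq_square)
  \<comment> \<open>This is still implicit, as \<open>D\<close> depends on \<open>g\<close>, but it
    shows that \<open>g\<close> is a positive multiple of \<open>B\<close>.\<close>
  have L: "?L \<longleftrightarrow> gmat g = (1 / (6 * sqrt D)) *\<^sub>R B"
    unfolding star_Q_form vol_factor[OF assms(2)]
    using D by (simp add: D_def[symmetric] B_def vec_eq_iff field_simps)
      (simp add: gmat_def)
  show ?thesis
  proof
    assume ?L
    define s where "s = 1 / (6 * sqrt D)"
    have s: "s > 0" "gmat g = s *\<^sub>R B"
      using L \<open>?L\<close> D by (auto simp: s_def)
    have "6 * s * sqrt (det (s *\<^sub>R B)) = 1"
      using D unfolding s(2)[symmetric] D_def[symmetric] by (simp add: s_def)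
    then have "36 * s ^ 9 * det B = 1"
      using key[OF s(1)] by simp
    then have "s ^ 9 = ?r ^ 9"
      using r(2) B by (metis mult_cancel_left mult_cancel_right less_irrefl zero_neq_numeral)
    then have "s = ?r"
      using s(1) r(1) power_eq_iff_eq_base[of 9 s ?r] by linarith
    then show "gmat g = ?r *\<^sub>R Q_mat \<phi>"
      using s by (simp add: B_def)
  next
    assume g: "gmat g = ?r *\<^sub>R Q_mat \<phi>"
    then have "(6 * ?r * sqrt D)\<^sup>2 = 1"
      using key[OF r(1)] r(2) by (simp add: D_def B_def)
    \<comment> \<open>Positivity excludes the root -1.\<close>
    moreover have "6 * ?r * sqrt D > 0"
      using r D by simp
    ultimately have "6 * ?r * sqrt D = 1"
      by (simp add: power2_eq_1_iff)
    then have "?r = 1 / (6 * sqrt D)"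
      using D by (simp add: field_simps)
    then show ?L
      using g L by (simp add: B_def)
  qed
qed

text \<open>By \<open>g2_equation_iff\<close> exactly one inner product solves the defining
  equation, so the description in \<open>g2_pt\<close> denotes it.\<close>

lemma inner_product_pt_g2_pt:
  assumes "posdef (Q_mat \<phi>)"
  shows "inner_product_pt (g2_pt \<phi>)"
proof -
  define r where "r = root 9 (1 / (36 * det (Q_mat \<phi>)))"
  \<comment> \<open>The solution prescribed by \<open>g2_equation_iff\<close>, set to 0 on lists of
    other lengths as \<open>inner_product_pt\<close> demands; this makes it unique as a function on
    all lists.\<close>
  define g0 :: comps where
    "g0 is = (if length is = 2 then r * Q_mat \<phi> $ (is ! 0) $ (is ! 1) else 0)" for "is"
  let ?P = "\<lambda>g. inner_product_pt g \<and>
     (\<forall>i j. 6 * g [i, j] = star_pt 7 g (Q_form \<phi> (axis i 1) (axis j 1)) [])"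
  have r: "r > 0"
    using assms by (simp add: r_def posdef_det_pos)
  have g0: "gmat g0 = r *\<^sub>R Q_mat \<phi>"
    by (simp add: gmat_def g0_def vec_eq_iff)
  have pos: "posdef (r *\<^sub>R Q_mat \<phi>)"
    using assms r by (simp add: posdef_def scaleR_matrix_vector_assoc[symmetric])
  have "?P g0"
    using pos g0 assms transpose_Q_mat[of \<phi>]
    by (simp add: inner_product_pt_iff g2_equation_iff r_def[symmetric] transpose_scalar)
       (simp add: g0_def)
  moreover have "g = g0" if "?P g" for g
  proof
    fix "is" :: "7 list"
    from that have g: "gmat g = gmat g0" "\<forall>is. length is \<noteq> 2 \<longrightarrow> g is = 0"
      using assms by (auto simp: inner_product_pt_iff g2_equation_iff g0 r_def)
    show "g is = g0 is"
    proof (cases "length is = 2")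
      case True
      then obtain i j where "is = [i, j]"
        by (auto simp: numeral_eq_Suc length_Suc_conv)
      with g(1) show ?thesis
        by (simp add: gmat_def vec_eq_iff)
    qed (use g(2) in \<open>simp add: g0_def\<close>)
  qed
  ultimately have "?P (g2_pt \<phi>)"
    unfolding g2_pt_def by (rule theI2) auto
  then show ?thesis ..
qed

section \<open>Symmetry of the inner product of tensors\<close>

text \<open>The inverse of a symmetric matrix is symmetric, so \<open>ginvs\<close> is unchanged
  when its two multi-indices are exchanged.\<close>

lemma ip_pt_commute:
  assumes "inner_product_pt g"
  shows "ip_pt k g S S' = ip_pt k g S' S"
proof -
  have "det (gmat g) > 0" "transpose (gmat g) = gmat g"
    using assms by (auto simp: inner_product_pt_iff posdef_det_pos)
  then have "transpose (ginv g) = ginv g"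
    unfolding ginv_def by (intro transpose_matrix_inv) (auto simp: invertible_det_nz)
  then have sym: "ginv g $ i $ j = ginv g $ j $ i" for i j
    by (simp add: vec_eq_iff Finite_Cartesian_Product.transpose_def)
  have ginvs: "ginvs g is js = ginvs g js is" if "is \<in> multi k" "js \<in> multi k" for "is" js
    using that unfolding ginvs_def multi_def by (auto intro!: prod.cong sym)
  have "(\<Sum>is\<in>multi k. \<Sum>js\<in>multi k. S is * S' js * ginvs g is js) =
      (\<Sum>is\<in>multi k. \<Sum>js\<in>multi k. S' js * S is * ginvs g js is)"
    by (intro sum.cong refl) (simp add: ginvs mult.commute)
  also have "\<dots> = (\<Sum>js\<in>multi k. \<Sum>is\<in>multi k. S' js * S is * ginvs g js is)"
    by (rule sum.swap)
  finally show ?thesis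
    by (simp add: ip_pt_def)
qed

lemma ip_g2_metric_commute:
  assumes "positive_form A \<phi>"
  shows "ip 3 (g2_metric \<phi>) \<phi> X = ip 3 (g2_metric \<phi>) X \<phi>"
proof (intro ext)
  fix c p
  show "ip 3 (g2_metric \<phi>) \<phi> X c p = ip 3 (g2_metric \<phi>) X \<phi> c p"
  proof (cases "c \<in> A \<and> p \<in> fst c")
    case True
    then have "posdef (Q_mat (\<phi> c p))"
      using assms by (simp add: positive_form_def posdef_def inner_Q_mat)
    then show ?thesis
      by (simp add: ip_def g2_metric_def ip_pt_commute[OF inner_product_pt_g2_pt])
  next
    \<comment> \<open>Off the chart \<open>\<phi>\<close> is 0 by convention, and both sides vanish
      whatever \<open>g2_pt\<close> is there.\<close>
    case False
    moreover have "tensor_field A 3 \<phi>"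
      using assms by (simp add: positive_form_def forms_def)
    ultimately have "\<phi> c p is = 0" for "is"
      unfolding tensor_field_def by blast
    then show ?thesis
      by (simp add: ip_def ip_pt_def)
  qed
qed

section \<open>The exterior derivative of a negated form\<close>

text \<open>Negation preserves differentiability and its failure, so the default value 0 of
  \<open>pdiff\<close> is taken on both sides at once.\<close>

lemma pdiff_minus: "pdiff c i (\<lambda>q. - f q) p = - pdiff c i f p"
proof -
  have eq: "in_coords c (\<lambda>q. - f q) = (\<lambda>y. - in_coords c f y)"
    by (simp add: in_coords_def)
  have "(\<lambda>y. - h y) differentiable F \<longleftrightarrow> h differentiable F" for h :: "real ^ 7 \<Rightarrow> real" and F
    using differentiable_minus[of h F] differentiable_minus[of "\<lambda>y. - h y" F] by auto
  moreover have "frechet_derivative (\<lambda>y. - h y) (at x) = (\<lambda>v. - frechet_derivative h (at x) v)"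
    if "h differentiable (at x)" for h :: "real ^ 7 \<Rightarrow> real" and x
    using that by (intro frechet_derivative_at[symmetric] has_derivative_minus)
      (simp add: frechet_derivative_works)
  ultimately show ?thesis
    by (simp add: pdiff_def eq)
qed

lemma ext_d_minus: "ext_d (- \<omega>) = - ext_d \<omega>"
  by (simp add: ext_d_def fun_eq_iff pdiff_minus sum_negf)


theorem theorem1p2:
  fixes A :: "'m::t2_space chart set"
    and C :: "'m tfield set"
    and G :: "'m tfield \<Rightarrow> 'm tfield \<Rightarrow> 'm tfield"
    and J :: "real set"
    and \<phi> u :: "real \<Rightarrow> 'm tfield"
  assumes "compact_oriented_manifold A"
    and "C \<in> de_rham A 3"
    and "moduli A C \<noteq> {}"
    and "green_operator A C G"
    and "open J" "is_interval J"
    and "dirichlet_geodesic A C G J \<phi>"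
    and "\<forall>t\<in>J. u t = G (\<phi> t) (time_deriv \<phi> t)"
  shows "\<forall>t\<in>J.
    (let g = g2_metric (\<phi> t); \<phi>\<^sub>t = time_deriv \<phi> t; \<phi>\<^sub>t\<^sub>t = time_deriv (time_deriv \<phi>) t;
         \<delta>u = codiff 3 g (u t)
     in \<phi>\<^sub>t = laplacian 3 g (u t) \<and>
        \<phi>\<^sub>t\<^sub>t = ext_d (
          - (ip 3 g \<phi>\<^sub>t (\<phi> t) \<cdot> \<delta>u)
          + (1/2) \<odot> codiff 3 g (ip 2 g \<delta>u \<delta>u \<cdot> \<phi> t - i_op 3 g (\<phi> t) (j_op 2 g \<delta>u \<delta>u))
          + (1/2) \<odot> i_op 2 g \<delta>u (j_op 3 g (\<phi> t) \<phi>\<^sub>t)))"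
proof (intro ballI)
  fix t assume t: "t \<in> J"
  define g where "g = g2_metric (\<phi> t)"
  define \<phi>' where "\<phi>' = time_deriv \<phi> t"
  define \<delta>u where "\<delta>u = codiff 3 g (u t)"
  define K where "K = codiff 3 g (ip 2 g \<delta>u \<delta>u \<cdot> \<phi> t - i_op 3 g (\<phi> t) (j_op 2 g \<delta>u \<delta>u))"
  define I where "I = i_op 2 g \<delta>u (j_op 3 g (\<phi> t) \<phi>')"
  have path: "\<phi> t \<in> moduli A C" "\<phi>' \<in> exact_forms A 3"
    and geod: "dirichlet_D G \<phi> (time_deriv \<phi>) t = 0"
    using assms(7) t by (auto simp: dirichlet_geodesic_def smooth_path_def \<phi>'_def)
  have u: "u t = G (\<phi> t) \<phi>'"
    using assms(8) t by (simp add: \<phi>'_def)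
  \<comment> \<open>The velocity is exact, so the characterisation of \<open>G\<close> applies to
    it.\<close>
  then have lap: "\<phi>' = laplacian 3 g (u t)"
    using assms(4) path unfolding green_operator_def g_def by metis
  have sym: "ip 3 g (\<phi> t) \<phi>' = ip 3 g \<phi>' (\<phi> t)"
    using path(1) unfolding g_def moduli_def by (intro ip_g2_metric_commute[of A]) auto
  \<comment> \<open>The form under \<open>ext_d\<close> in the connection when the vector field is
    the velocity: then \<open>v = u\<close>, and the symmetric pairs of terms coincide.\<close>
  define W where "W = (1/2) \<odot> (ip 3 g (\<phi> t) \<phi>' \<cdot> \<delta>u + ip 3 g (\<phi> t) \<phi>' \<cdot> \<delta>u)
    - (1/2) \<odot> K - (1/4) \<odot> (I + I)"
  have "time_deriv (time_deriv \<phi>) t + ext_d W = 0"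
    using geod by (simp add: dirichlet_D_def Let_def W_def K_def I_def \<delta>u_def u
        flip: g_def \<phi>'_def)
  then have "time_deriv (time_deriv \<phi>) t = ext_d (- W)"
    by (simp add: ext_d_minus eq_neg_iff_add_eq_0)
  \<comment> \<open>The equal terms combine, doubling 1/2 to 1 and 1/4 to 1/2. The computation takes
    place under \<open>ext_d\<close>, so only \<open>ext_d_minus\<close> is asked of the
    derivative.\<close>
  also have "- W = - (ip 3 g \<phi>' (\<phi> t) \<cdot> \<delta>u) + (1/2) \<odot> K + (1/2) \<odot> I"
    by (simp add: W_def sym fun_eq_iff cmult_def fmult_def algebra_simps)
  finally show "let g = g2_metric (\<phi> t); \<phi>\<^sub>t = time_deriv \<phi> t; \<phi>\<^sub>t\<^sub>t = time_deriv (time_deriv \<phi>) t;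
         \<delta>u = codiff 3 g (u t)
     in \<phi>\<^sub>t = laplacian 3 g (u t) \<and>
        \<phi>\<^sub>t\<^sub>t = ext_d (
          - (ip 3 g \<phi>\<^sub>t (\<phi> t) \<cdot> \<delta>u)
          + (1/2) \<odot> codiff 3 g (ip 2 g \<delta>u \<delta>u \<cdot> \<phi> t - i_op 3 g (\<phi> t) (j_op 2 g \<delta>u \<delta>u))
          + (1/2) \<odot> i_op 2 g \<delta>u (j_op 3 g (\<phi> t) \<phi>\<^sub>t))"
    unfolding Let_def g_def[symmetric] \<phi>'_def[symmetric] \<delta>u_def[symmetric] K_def[symmetric] I_def[symmetric]
    using lap by blast
qed

end
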